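(* Let $m\ge 1$, $a>1$ and $b\ge 3$ be integers. Let $C_b$ be the cycle on $b$ vertices, $\overline{K}_a$ the graph with $a$ vertices and no edges, $C_b\circ\overline{K}_a$ their lexicographic product, and $m(C_b\circ\overline{K}_a)$ the disjoint union of $m$ copies of it. Then $$\theta\bigl(m(C_b\circ\overline{K}_a)\bigr)=\begin{cases}0 & \text{if } a \text{ is even, or } mab \text{ is odd, or } (a \text{ is odd and } b\equiv 0 \pmod 4),\\ 1 & \text{otherwise}.\end{cases}$$
   Context: All graphs are simple and finite; $N(u)$ denotes the set of vertices adjacent to $u$. The lexicographic product $G\circ H$ of graphs $G$ and $H$ has vertex set $V(G)\times V(H)$, and $(u,v)$ and $(u',v')$ are adjacent if and only if $u$ is adjacent to $u'$ in $G$, or $u=u'$ and $v$ is adjacent to $v'$ in $H$. Let $G$ be a graph on $n$ vertices and $S$ a set of $n$ (distinct) positive integers. $G$ is $S$-magic if there is a bijection $l:V(G)\to S$ and a constant $\mu'$ such that $\sum_{v\in N(u)}l(v)=\mu'$ for every vertex $u$ of $G$. Let $\eta(S)$ denote the largest element of $S$, and let $i(G)$ be the infimum of $\eta(S)$ over all sets $S$ of $n$ positive integers for which $G$ is $S$-magic. The distance magic index of $G$ is $\theta(G)=i(G)-n$ (it is infinite if $G$ is not $S$-magic for any $S$). *)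

theory Defs
  imports "Graph_Theory.Pair_Digraph" "HOL-Library.Extended_Nat"
begin

text \<open>
  A finite simple graph is a \<^locale>\<open>pair_graph\<close>: every undirected edge is represented by its
  two arcs.
\<close>

definition neighbours :: "'a pair_pre_digraph \<Rightarrow> 'a \<Rightarrow> 'a set" where
  "neighbours G u = {v \<in> pverts G. (u, v) \<in> parcs G}"

definition cycle_graph :: "nat \<Rightarrow> nat pair_pre_digraph" where
  "cycle_graph b =
     \<lparr> pverts = {..<b},
       parcs = {(i, j). i < b \<and> j < b \<and> (j = (i + 1) mod b \<or> i = (j + 1) mod b)} \<rparr>"

definition empty_graph :: "nat \<Rightarrow> nat pair_pre_digraph" where
  "empty_graph a = \<lparr> pverts = {..<a}, parcs = {} \<rparr>"

definition lexicographic_product ::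
  "'a pair_pre_digraph \<Rightarrow> 'b pair_pre_digraph \<Rightarrow> ('a \<times> 'b) pair_pre_digraph" where
  "lexicographic_product G H =
     \<lparr> pverts = pverts G \<times> pverts H,
       parcs = {((u, v), (u', v')).
         (u, v) \<in> pverts G \<times> pverts H \<and> (u', v') \<in> pverts G \<times> pverts H \<and>
         ((u, u') \<in> parcs G \<or> u = u' \<and> (v, v') \<in> parcs H)} \<rparr>"

definition disjoint_copies :: "nat \<Rightarrow> 'a pair_pre_digraph \<Rightarrow> (nat \<times> 'a) pair_pre_digraph" where
  "disjoint_copies m G =
     \<lparr> pverts = {..<m} \<times> pverts G,
       parcs = {((i, u), (j, v)). i < m \<and> j = i \<and> (u, v) \<in> parcs G} \<rparr>"

definition S_magic :: "'a pair_pre_digraph \<Rightarrow> nat set \<Rightarrow> bool" where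
  "S_magic G S \<longleftrightarrow>
     finite S \<and> card S = card (pverts G) \<and> (\<forall>s\<in>S. s > 0) \<and>
     (\<exists>l \<mu>. bij_betw l (pverts G) S \<and>
        (\<forall>u\<in>pverts G. (\<Sum>v\<in>neighbours G u. l v) = \<mu>))"

text \<open>
  The infimum is taken in \<^typ>\<open>enat\<close>, so it is \<open>\<infinity>\<close> if there is no suitable set \<open>S\<close>.
\<close>

definition min_max_label :: "'a pair_pre_digraph \<Rightarrow> enat" where
  "min_max_label G = (INF S \<in> {S. S_magic G S}. enat (Max S))"

text \<open>
  The truncated subtraction of \<^typ>\<open>enat\<close> is harmless for nonempty graphs: a set of \<open>n \<ge> 1\<close>
  positive integers has maximum at least \<open>n\<close>. Moreover \<open>\<infinity> - enat n = \<infinity>\<close>.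
\<close>

definition distance_magic_index :: "'a pair_pre_digraph \<Rightarrow> enat" where
  "distance_magic_index G = min_max_label G - enat (card (pverts G))"


lemma pair_graphI:
  assumes "finite (pverts G)" "parcs G \<subseteq> pverts G \<times> pverts G"
    and "\<And>u. (u, u) \<notin> parcs G" "\<And>u v. (u, v) \<in> parcs G \<Longrightarrow> (v, u) \<in> parcs G"
  shows "pair_graph G"
proof -
  have "finite (parcs G)"
    using assms(1,2) by (meson finite_SigmaI finite_subset)
  moreover have "symmetric (with_proj G)"
    using assms(4) by (auto simp: symmetric_def sym_def arcs_ends_def arc_to_ends_def)
  ultimately show ?thesis
    using assms by unfold_locales auto
qed

lemma pair_graph_cycle_graph:
  assumes "b \<ge> 3"
  shows "pair_graph (cycle_graph b)"
proof (rule pair_graphI)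
  fix u show "(u, u) \<notin> parcs (cycle_graph b)"
    using assms by (cases "u + 1 = b") (auto simp: cycle_graph_def mod_if)
qed (auto simp: cycle_graph_def)

lemma pair_graph_empty_graph: "pair_graph (empty_graph a)"
  by (rule pair_graphI) (auto simp: empty_graph_def)

lemma pair_graph_facts:
  assumes "pair_graph G"
  shows "finite (pverts G)" "(u, v) \<in> parcs G \<Longrightarrow> u \<in> pverts G \<and> v \<in> pverts G"
    "(u, u) \<notin> parcs G" "(u, v) \<in> parcs G \<Longrightarrow> (v, u) \<in> parcs G"
proof -
  interpret pair_graph G by fact
  show "finite (pverts G)" by simp
  show "(u, v) \<in> parcs G \<Longrightarrow> u \<in> pverts G \<and> v \<in> pverts G"
    by (auto dest: in_arcsD1 in_arcsD2)
  show "(u, u) \<notin> parcs G" using no_loops' by blast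
  show "(u, v) \<in> parcs G \<Longrightarrow> (v, u) \<in> parcs G" by (rule arcs_symmetric)
qed

lemma pair_graph_lexicographic_product:
  assumes "pair_graph G" "pair_graph H"
  shows "pair_graph (lexicographic_product G H)"
  using pair_graph_facts[OF assms(1)] pair_graph_facts[OF assms(2)]
  by (intro pair_graphI) (auto simp: lexicographic_product_def)

lemma pair_graph_disjoint_copies:
  assumes "pair_graph G"
  shows "pair_graph (disjoint_copies m G)"
  using pair_graph_facts[OF assms]
  by (intro pair_graphI) (auto simp: disjoint_copies_def)

lemma card_le_min_max_label:
  assumes "pverts G \<noteq> {}" "finite (pverts G)"
  shows "enat (card (pverts G)) \<le> min_max_label G"
  unfolding min_max_label_def
proof (rule INF_greatest)
  fix S assume "S \<in> {S. S_magic G S}"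
  then have S: "finite S" "card S = card (pverts G)" "\<forall>s\<in>S. s > 0"
    by (auto simp: S_magic_def)
  then have "S \<subseteq> {1..Max S}" by (auto simp: Suc_le_eq)
  from card_mono[OF _ this] S(2) show "enat (card (pverts G)) \<le> enat (Max S)" by simp
qed

end

theory Submission
  imports Defs
begin

text \<open>
  Write \<open>w (i, j)\<close> for the sum of the \<open>a\<close> labels on the fibre over the \<open>j\<close>-th cycle vertex in the
  \<open>i\<close>-th copy. A labelling is magic iff the fibre sums at cyclic distance two always add up to the
  same constant \<open>\<mu>\<close> (\<open>S_magic_iff\<close>). So the question is which sums can be obtained by distributing
  a set \<open>S\<close> of labels over \<open>k = m b\<close> blocks of size \<open>a\<close>.

  Upper bounds. Two further columns, one increasing and one decreasing, of the next \<open>2 k\<close> labels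
  change all block sums by the same amount (\<open>has_block_sums_add_columns\<close>), so blocks of even size
  are built from empty blocks and blocks of odd size from triples. The labels \<open>1, \<dots>, 3 k\<close> can be
  split into \<open>k\<close> triples which have equal sums if \<open>k\<close> is odd; if \<open>k\<close> is even, half of the sums are
  \<open>p\<close> and half are \<open>p + 1\<close> (\<open>has_block_sums_triples\<close>). The latter suffices if \<open>4\<close> divides \<open>b\<close>, since
  then the cycle can be two-coloured so that vertices at distance two have different colours.
  If \<open>k\<close> is even, leaving out one label and using \<open>3 k + 1\<close> instead makes all sums of triples equal,
  so for odd \<open>a\<close> and even \<open>k\<close> the maximal label \<open>n + 1\<close> is possible, where \<open>n = m a b\<close>.

  Lower bound. If \<open>4\<close> does not divide \<open>b\<close>, then \<open>w (i, j) = w (i, j + 4)\<close> forces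
  \<open>w (i, j) = w (i, j + 2)\<close>, hence \<open>2 w (i, j) = \<mu>\<close> for all blocks. Labels \<open>1, \<dots>, n\<close>
  would then give \<open>\<mu> = a (n + 1)\<close>, which is odd if \<open>a\<close> is odd and \<open>m b\<close> is even
  (\<open>not_S_magic_initial_segment\<close>).
\<close>

section \<open>Distributing labels over blocks of equal size\<close>

text \<open>
  The labels in \<open>S\<close> can be distributed bijectively over blocks of \<open>a\<close> places each, indexed by \<open>I\<close>,
  such that the block \<open>x\<close> has label sum \<open>w x\<close>.
\<close>

definition has_block_sums :: "'i set \<Rightarrow> nat \<Rightarrow> nat set \<Rightarrow> ('i \<Rightarrow> nat) \<Rightarrow> bool" where
  "has_block_sums I a S w \<longleftrightarrow>
     (\<exists>f. bij_betw f (I \<times> {..<a}) S \<and> (\<forall>x\<in>I. (\<Sum>r<a. f (x, r)) = w x))"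

lemma has_block_sums_reindex:
  assumes e: "bij_betw e I J" and "has_block_sums J a S w"
  shows "has_block_sums I a S (\<lambda>x. w (e x))"
proof -
  from assms(2) obtain f where f: "bij_betw f (J \<times> {..<a}) S"
    and w: "\<forall>x\<in>J. (\<Sum>r<a. f (x, r)) = w x"
    unfolding has_block_sums_def by blast
  have "bij_betw (map_prod e id) (I \<times> {..<a}) (J \<times> {..<a})"
    using e by (intro bij_betw_map_prod) auto
  then have "bij_betw (f \<circ> map_prod e id) (I \<times> {..<a}) S"
    using f by (rule bij_betw_trans)
  moreover have "\<forall>x\<in>I. (\<Sum>r<a. (f \<circ> map_prod e id) (x, r)) = w (e x)"
    using w e by (auto simp: bij_betw_def)
  ultimately show ?thesis
    unfolding has_block_sums_def by blast
qed

lemma has_block_sums_cong: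
  assumes "has_block_sums I a S w" "\<And>x. x \<in> I \<Longrightarrow> w x = w' x"
  shows "has_block_sums I a S w'"
  using assms unfolding has_block_sums_def by metis

lemma has_block_sums_total:
  assumes "has_block_sums I a S w"
  shows "(\<Sum>x\<in>I. w x) = \<Sum>S"
proof -
  from assms obtain f where f: "bij_betw f (I \<times> {..<a}) S"
    and w: "\<forall>x\<in>I. (\<Sum>r<a. f (x, r)) = w x"
    unfolding has_block_sums_def by blast
  have "\<Sum>S = (\<Sum>p\<in>I \<times> {..<a}. f p)"
    using sum.reindex_bij_betw[OF f, of "\<lambda>x. x"] by simp
  also have "\<dots> = (\<Sum>x\<in>I. \<Sum>r<a. f (x, r))"
    by (simp add: sum.cartesian_product)
  also have "\<dots> = (\<Sum>x\<in>I. w x)"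
    using w by (intro sum.cong) auto
  finally show ?thesis ..
qed

lemma bij_betwI_card:
  assumes "inj_on f A" "f ` A \<subseteq> B" "finite B" "card A = card B"
  shows "bij_betw f A B"
  using assms by (simp add: bij_betw_def card_image card_subset_eq)

lemma has_block_sums_add_two_columns:
  assumes "has_block_sums {..<k} a S w" "S \<subseteq> {..M}"
  shows "has_block_sums {..<k} (a + 2) (S \<union> {M + 1..M + 2 * k}) (\<lambda>q. w q + (2 * M + 2 * k + 1))"
proof -
  from assms(1) obtain f where f: "bij_betw f ({..<k} \<times> {..<a}) S"
    and w: "\<forall>q<k. (\<Sum>r<a. f (q, r)) = w q"
    unfolding has_block_sums_def by auto
  define g where "g = (\<lambda>(q, r). if r < a then f (q, r)
    else if r = a then M + 1 + q else M + 2 * k - q)"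
  have old: "bij_betw g ({..<k} \<times> {..<a}) S"
    using f by (subst bij_betw_cong[where g = f]) (auto simp: g_def)
  have new: "bij_betw g ({..<k} \<times> {a, a + 1}) {M + 1..M + 2 * k}"
  proof (rule bij_betwI_card)
    show "inj_on g ({..<k} \<times> {a, a + 1})"
      by (auto simp: inj_on_def g_def)
  qed (auto simp: g_def)
  have "{..<k} \<times> {..<a} \<union> {..<k} \<times> {a, a + 1} = {..<k} \<times> {..<a + 2}"
    by auto
  moreover have "S \<inter> {M + 1..M + 2 * k} = {}"
    using assms(2) by auto
  ultimately have "bij_betw g ({..<k} \<times> {..<a + 2}) (S \<union> {M + 1..M + 2 * k})"
    using bij_betw_combine[OF old new] by simp
  moreover have "(\<Sum>r<a + 2. g (q, r)) = w q + (2 * M + 2 * k + 1)" if "q < k" for q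
  proof -
    have "(\<Sum>r<a. g (q, r)) = w q"
      using w that by (simp add: g_def)
    then show ?thesis
      using that by (simp add: g_def)
  qed
  ultimately show ?thesis
    unfolding has_block_sums_def by blast
qed

lemma has_block_sums_add_columns:
  assumes "has_block_sums {..<k} a S w" "S \<subseteq> {..M}"
  shows "\<exists>C. has_block_sums {..<k} (a + 2 * t) (S \<union> {M + 1..M + 2 * k * t}) (\<lambda>q. w q + C)"
proof (induction t)
  case 0
  have "has_block_sums {..<k} (a + 2 * 0) (S \<union> {M + 1..M + 2 * k * 0}) (\<lambda>q. w q + 0)"
    using assms(1) by simp
  then show ?case ..
next
  case (Suc t)
  then obtain C where
    "has_block_sums {..<k} (a + 2 * t) (S \<union> {M + 1..M + 2 * k * t}) (\<lambda>q. w q + C)"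
    by blast
  moreover have "S \<union> {M + 1..M + 2 * k * t} \<subseteq> {..M + 2 * k * t}"
    using assms(2) by fastforce
  ultimately have "has_block_sums {..<k} (a + 2 * t + 2)
      (S \<union> {M + 1..M + 2 * k * t} \<union> {M + 2 * k * t + 1..M + 2 * k * t + 2 * k})
      (\<lambda>q. w q + C + (2 * (M + 2 * k * t) + 2 * k + 1))"
    by (rule has_block_sums_add_two_columns)
  moreover have "S \<union> {M + 1..M + 2 * k * t} \<union> {M + 2 * k * t + 1..M + 2 * k * t + 2 * k}
      = S \<union> {M + 1..M + 2 * k * Suc t}"
    by auto
  ultimately have "has_block_sums {..<k} (a + 2 * Suc t) (S \<union> {M + 1..M + 2 * k * Suc t})
      (\<lambda>q. w q + (C + (2 * (M + 2 * k * t) + 2 * k + 1)))"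
    by (simp only: add.assoc mult_Suc_right add.commute[of 2])
  then show ?case ..
qed

lemma has_block_sums_even:
  assumes "even a"
  shows "\<exists>C. has_block_sums {..<k} a {1..k * a} (\<lambda>_. C)"
proof -
  have "has_block_sums {..<k} 0 {} (\<lambda>_. 0)"
    by (simp add: has_block_sums_def bij_betw_def)
  then obtain C where "has_block_sums {..<k} (0 + 2 * (a div 2))
      ({} \<union> {0 + 1..0 + 2 * k * (a div 2)}) (\<lambda>_. 0 + C)"
    using has_block_sums_add_columns[of k 0 "{}" _ 0] by blast
  moreover have "2 * k * (a div 2) = k * a"
    using assms by auto
  ultimately show ?thesis
    using assms by auto
qed

text \<open>
  The blocks are \<open>(q + 1, k + \<sigma> q, 2 k + d + \<tau> q)\<close>, where \<open>\<sigma>\<close> exchanges the lower and the upper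
  half of the blocks, so that \<open>q + \<sigma> q\<close> grows in steps of two in each half; \<open>\<tau>\<close> then compensates
  by running down through the odd numbers in the first half and through the even numbers in the
  second half. The parameter \<open>d\<close> opens a gap of \<open>d\<close> unused labels in the middle of the second
  column, which raises the sums of the first half by \<open>d\<close> relative to those of the second half.
\<close>

lemma has_block_sums_triples:
  fixes k d :: nat
  defines "c \<equiv> k div 2" and "h \<equiv> k - k div 2"
  shows "has_block_sums {..<k} 3 ({1..3 * k + d} - {k + c + 1..k + c + d})
    (\<lambda>q. if q < h then 3 * k + 2 * d + c + 2 * h + 1 else 3 * k + d + 2 * c + h + 2)"
proof -
  define f :: "nat \<times> nat \<Rightarrow> nat" where "f = (\<lambda>(q, r).
     if r = 0 then q + 1
     else if r = 1 then (if q < h then k + c + q + 1 + d else k + (q - h) + 1)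
     else (if q < h then 2 * k + d + (2 * h - 1 - 2 * q)
           else 2 * k + d + (2 * c - 2 * (q - h))))"
  have k: "k = c + h" and ch: "h = c \<or> h = c + 1"
    unfolding c_def h_def by auto
  have B: "({..<3}::nat set) = {0, 1, 2}" by auto
  have "bij_betw f ({..<k} \<times> {..<3}) ({1..3 * k + d} - {k + c + 1..k + c + d})"
  proof (rule bij_betwI_card)
    have "q = q' \<and> r = r'"
      if "q < k" "q' < k" "r < 3" "r' < 3" and eq: "f (q, r) = f (q', r')" for q q' r r'
    proof -
      have col0: "f (x, 0) \<in> {1..k}" if "x < k" for x
        using that by (simp add: f_def)
      have col1: "f (x, 1) \<in> {k + 1..2 * k + d}" if "x < k" for x
        using that k by (auto simp: f_def)
      have col2: "f (x, 2) \<in> {2 * k + d + 1..3 * k + d}" if "x < k" for x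
        using that k ch by (auto simp: f_def)
      have "r \<in> {0, 1, 2}" "r' \<in> {0, 1, 2}"
        using that by auto
      then have r: "r = r'"
        using col0[OF that(1)] col0[OF that(2)] col1[OF that(1)] col1[OF that(2)]
          col2[OF that(1)] col2[OF that(2)] eq by auto
      have "q = q'" if "r = 0"
        using eq r that by (simp add: f_def)
      moreover have "q = q'" if "r = 1"
        using eq r that \<open>q < k\<close> \<open>q' < k\<close> k by (auto simp: f_def split: if_splits)
      moreover have "q = q'" if "r = 2"
      proof -
        have par: "even (f (x, 2) - (2 * k + d)) \<longleftrightarrow> \<not> x < h" for x
          by (auto simp: f_def)
        have "q < h \<longleftrightarrow> q' < h"
          using par[of q] par[of q'] eq r that by simp
        then show ?thesis
          using eq r that \<open>q < k\<close> \<open>q' < k\<close> k by (auto simp: f_def split: if_splits)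
      qed
      ultimately show ?thesis
        using r \<open>r \<in> {0, 1, 2}\<close> by blast
    qed
    then show "inj_on f ({..<k} \<times> {..<3})"
      unfolding inj_on_def by auto
    show "f ` ({..<k} \<times> {..<3}) \<subseteq> {1..3 * k + d} - {k + c + 1..k + c + d}"
      unfolding B using k ch by (auto simp: f_def split: if_splits)
    have "{k + c + 1..k + c + d} \<subseteq> {1..3 * k + d}"
      using k by auto
    then show "card ({..<k} \<times> {..<3::nat}) = card ({1..3 * k + d} - {k + c + 1..k + c + d})"
      by (simp add: card_Diff_subset)
  qed auto
  moreover have "(\<Sum>r<3. f (q, r)) = (if q < h then 3 * k + 2 * d + c + 2 * h + 1
      else 3 * k + d + 2 * c + h + 2)" if "q < k" for q
    unfolding B using that k by (auto simp: f_def)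
  ultimately show ?thesis
    unfolding has_block_sums_def by blast
qed

text \<open>
  The sums of the two halves agree if \<open>h + d = c + 1\<close>, that is, for \<open>d = 0\<close> if \<open>k\<close> is odd and for
  \<open>d = 1\<close> if \<open>k\<close> is even; for \<open>d = 0\<close> and \<open>k\<close> even they differ by one.
\<close>

lemma has_block_sums_odd:
  fixes k a d :: nat
  defines "c \<equiv> k div 2" and "h \<equiv> k - k div 2"
  assumes "odd a" "a \<ge> 3"
  shows "\<exists>C. has_block_sums {..<k} a ({1..k * a + d} - {k + c + 1..k + c + d})
    (\<lambda>q. if q < h then C + h + d else C + c + 1)"
proof -
  define t where "t = (a - 3) div 2"
  have a: "a = 3 + 2 * t"
    using assms(3,4) unfolding t_def by presburger
  have sub: "{1..3 * k + d} - {k + c + 1..k + c + d} \<subseteq> {..3 * k + d}"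
    by auto
  obtain C where C: "has_block_sums {..<k} a
      ({1..3 * k + d} - {k + c + 1..k + c + d} \<union> {3 * k + d + 1..3 * k + d + 2 * k * t})
      (\<lambda>q. (if q < h then 3 * k + 2 * d + c + 2 * h + 1 else 3 * k + d + 2 * c + h + 2) + C)"
    using has_block_sums_add_columns[OF has_block_sums_triples[of k d, folded c_def h_def] sub, of t]
    unfolding a by blast
  have "3 * k + d + 2 * k * t = k * a + d"
    unfolding a by (simp add: algebra_simps)
  moreover have "k + c \<le> 3 * k"
    unfolding c_def by auto
  ultimately have S: "{1..3 * k + d} - {k + c + 1..k + c + d} \<union> {3 * k + d + 1..3 * k + d + 2 * k * t}
      = {1..k * a + d} - {k + c + 1..k + c + d}"
    by auto
  have "has_block_sums {..<k} a ({1..k * a + d} - {k + c + 1..k + c + d})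
      (\<lambda>q. if q < h then (3 * k + d + c + h + 1 + C) + h + d else (3 * k + d + c + h + 1 + C) + c + 1)"
    by (rule has_block_sums_cong[OF C[unfolded S]]) auto
  then show ?thesis
    by blast
qed

section \<open>Magic labellings in terms of fibre sums\<close>

text \<open>
  The disjoint union of \<open>m\<close> copies of the lexicographic product of the cycle on \<open>b\<close> vertices with the
  edgeless graph on \<open>a\<close> vertices; the vertex \<open>(i, j, r)\<close> is the \<open>r\<close>-th vertex of the fibre over the
  cycle vertex \<open>j\<close> in copy \<open>i\<close>.
\<close>

abbreviation cycle_blowups :: "nat \<Rightarrow> nat \<Rightarrow> nat \<Rightarrow> (nat \<times> nat \<times> nat) pair_pre_digraph" where
  "cycle_blowups m b a \<equiv>
     disjoint_copies m (lexicographic_product (cycle_graph b) (empty_graph a))"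

lemma pverts_cycle_blowups:
  "pverts (cycle_blowups m b a) = {..<m} \<times> {..<b} \<times> {..<a}"
  by (simp add: disjoint_copies_def lexicographic_product_def cycle_graph_def empty_graph_def)

lemma neighbours_cycle_blowups:
  assumes "i < m" "j < b" "r < a"
  shows "neighbours (cycle_blowups m b a) (i, j, r)
    = {i} \<times> {(j + b - 1) mod b, (j + 1) mod b} \<times> {..<a}"
proof -
  have "j = (j' + 1) mod b \<longleftrightarrow> j' = (j + b - 1) mod b" if "j' < b" for j'
    using that assms(2) by (cases "j = 0"; cases "j' + 1 = b") (auto simp: mod_if)
  moreover have "(j + b - 1) mod b < b" "(j + 1) mod b < b"
    using assms(2) by auto
  ultimately show ?thesis
    using assms
    unfolding neighbours_def pverts_cycle_blowups
    by (auto simp: disjoint_copies_def lexicographic_product_def cycle_graph_def empty_graph_def)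
qed

lemma sum_neighbours_cycle_blowups:
  fixes l :: "nat \<times> nat \<times> nat \<Rightarrow> nat"
  assumes "i < m" "j < b" "r < a" "b \<ge> 3"
  shows "(\<Sum>v\<in>neighbours (cycle_blowups m b a) (i, j, r). l v)
    = (\<Sum>r<a. l (i, (j + b - 1) mod b, r)) + (\<Sum>r<a. l (i, (j + 1) mod b, r))"
proof -
  have "(j + b - 1) mod b \<noteq> (j + 1) mod b"
    using assms by (cases "j = 0"; cases "j + 1 = b") (auto simp: mod_if)
  moreover have "(\<Sum>v\<in>{i} \<times> J \<times> {..<a}. l v) = (\<Sum>j\<in>J. \<Sum>r<a. l (i, j, r))" for J
    by (simp add: sum.cartesian_product')
  ultimately show ?thesis
    using assms by (simp add: neighbours_cycle_blowups)
qed

lemma S_magic_iff: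
  assumes "a \<ge> 1" "b \<ge> 3"
  shows "S_magic (cycle_blowups m b a) S \<longleftrightarrow> (\<forall>s\<in>S. s > 0) \<and>
    (\<exists>w \<mu>. has_block_sums ({..<m} \<times> {..<b}) a S w \<and>
       (\<forall>i<m. \<forall>j. w (i, j mod b) + w (i, (j + 2) mod b) = \<mu>))"
    (is "?L \<longleftrightarrow> ?R")
proof
  assume ?L
  then obtain l \<mu> where l: "bij_betw l ({..<m} \<times> {..<b} \<times> {..<a}) S"
    and \<mu>: "\<forall>u\<in>{..<m} \<times> {..<b} \<times> {..<a}. (\<Sum>v\<in>neighbours (cycle_blowups m b a) u. l v) = \<mu>"
    and pos: "\<forall>s\<in>S. s > 0"
    unfolding S_magic_def pverts_cycle_blowups by blast
  define w where "w = (\<lambda>(i, j). \<Sum>r<a. l (i, j, r))"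
  have "bij_betw (\<lambda>((i, j), r). (i, j, r)) (({..<m} \<times> {..<b}) \<times> {..<a}) ({..<m} \<times> {..<b} \<times> {..<a})"
    by (rule bij_betwI[where g = "\<lambda>(i, j, r). ((i, j), r)"]) auto
  from bij_betw_trans[OF this l] have "has_block_sums ({..<m} \<times> {..<b}) a S w"
    unfolding has_block_sums_def w_def
    by (intro exI[of _ "l \<circ> (\<lambda>((i, j), r). (i, j, r))"]) auto
  moreover have "w (i, j mod b) + w (i, (j + 2) mod b) = \<mu>" if "i < m" for i j
  proof -
    have "(\<Sum>v\<in>neighbours (cycle_blowups m b a) (i, (j + 1) mod b, 0). l v) = \<mu>"
      using \<mu> that assms by auto
    moreover have "((j + 1) mod b + b - 1) mod b = j mod b"
    proof -
      have "((j + 1) mod b + b - 1) mod b = ((j + 1) mod b + (b - 1)) mod b"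
        using assms by simp
      also have "\<dots> = (j + b) mod b"
        using assms unfolding mod_add_left_eq by simp
      finally show ?thesis by simp
    qed
    moreover have "((j + 1) mod b + 1) mod b = (j + 2) mod b"
      unfolding mod_add_left_eq by simp
    ultimately show ?thesis
      using that assms by (simp add: sum_neighbours_cycle_blowups w_def)
  qed
  ultimately show ?R
    using pos by blast
next
  assume ?R
  then obtain w \<mu> f where pos: "\<forall>s\<in>S. s > 0"
    and f: "bij_betw f (({..<m} \<times> {..<b}) \<times> {..<a}) S"
    and w: "\<forall>x\<in>{..<m} \<times> {..<b}. (\<Sum>r<a. f (x, r)) = w x"
    and \<mu>: "\<forall>i<m. \<forall>j. w (i, j mod b) + w (i, (j + 2) mod b) = \<mu>"
    unfolding has_block_sums_def by blast
  define l where "l = (\<lambda>(i, j, r). f ((i, j), r))"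
  have "bij_betw (\<lambda>(i, j, r). ((i, j), r)) ({..<m} \<times> {..<b} \<times> {..<a}) (({..<m} \<times> {..<b}) \<times> {..<a})"
    by (rule bij_betwI[where g = "\<lambda>((i, j), r). (i, j, r)"]) auto
  from bij_betw_trans[OF this f] have l: "bij_betw l ({..<m} \<times> {..<b} \<times> {..<a}) S"
    by (rule bij_betw_cong[THEN iffD1, rotated]) (auto simp: l_def)
  have "(\<Sum>v\<in>neighbours (cycle_blowups m b a) (i, j, r). l v) = \<mu>"
    if "i < m" "j < b" "r < a" for i j r
  proof -
    have "(j + b - 1) mod b < b" "(j + 1) mod b < b"
      using assms by auto
    then have "(\<Sum>v\<in>neighbours (cycle_blowups m b a) (i, j, r). l v)
        = w (i, (j + b - 1) mod b) + w (i, (j + 1) mod b)"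
      using that assms w by (simp add: sum_neighbours_cycle_blowups l_def)
    also have "(j + 1) mod b = ((j + b - 1) + 2) mod b"
    proof -
      have "(j + b - 1) + 2 = j + 1 + b"
        using assms by simp
      then show ?thesis
        by (simp only: mod_add_self2)
    qed
    also have "w (i, (j + b - 1) mod b) + w (i, \<dots>) = \<mu>"
      using \<mu> that by blast
    finally show ?thesis .
  qed
  moreover have "finite S" "card S = card ({..<m} \<times> {..<b} \<times> {..<a})"
    using l bij_betw_finite bij_betw_same_card by force+
  ultimately show ?L
    using pos l unfolding S_magic_def pverts_cycle_blowups by blast
qed

section \<open>The distance magic index of a graph\<close>

lemma distance_magic_index_eq_0:
  assumes "S_magic G {1..card (pverts G)}" "pverts G \<noteq> {}" "finite (pverts G)"
  shows "distance_magic_index G = 0"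
proof -
  have "card (pverts G) > 0"
    using assms by (simp add: card_gt_0_iff)
  then have "Max {1..card (pverts G)} = card (pverts G)"
    by (intro Max_eqI) auto
  then have "min_max_label G \<le> enat (card (pverts G))"
    using INF_lower[of "{1..card (pverts G)}" "{S. S_magic G S}" "\<lambda>S. enat (Max S)"] assms(1)
    unfolding min_max_label_def by simp
  with card_le_min_max_label[OF assms(2,3)] have "min_max_label G = enat (card (pverts G))"
    by simp
  then show ?thesis
    unfolding distance_magic_index_def by (simp add: zero_enat_def)
qed

lemma distance_magic_index_eq_1:
  assumes "\<not> S_magic G {1..card (pverts G)}"
    and "S_magic G S" "Max S = card (pverts G) + 1"
  shows "distance_magic_index G = 1"
proof -
  have "min_max_label G \<le> enat (card (pverts G) + 1)"
    using INF_lower[of S "{S. S_magic G S}" "\<lambda>S. enat (Max S)"] assms(2,3)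
    unfolding min_max_label_def by simp
  moreover have "enat (card (pverts G) + 1) \<le> min_max_label G"
    unfolding min_max_label_def
  proof (rule INF_greatest)
    fix T assume "T \<in> {S. S_magic G S}"
    then have T: "S_magic G T" by simp
    then have "finite T" "card T = card (pverts G)" "\<forall>s\<in>T. s > 0"
      by (auto simp: S_magic_def)
    moreover from this have "T \<subseteq> {1..card (pverts G)}" if "Max T \<le> card (pverts G)"
      using that by (auto simp: Suc_le_eq intro: order_trans[OF Max_ge])
    ultimately have "T = {1..card (pverts G)}" if "Max T \<le> card (pverts G)"
      using that by (intro card_subset_eq) auto
    then show "enat (card (pverts G) + 1) \<le> enat (Max T)"
      using T assms(1) by (cases "Max T \<le> card (pverts G)") auto
  qed
  ultimately have "min_max_label G = enat (card (pverts G) + 1)"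
    by (rule antisym)
  then show ?thesis
    unfolding distance_magic_index_def by (simp add: one_enat_def)
qed

section \<open>Existence and non-existence of magic labellings\<close>

lemma bij_betw_blocks:
  "\<exists>e. bij_betw e ({..<m} \<times> {..<b}) {..<m * b :: nat}"
  by (rule finite_same_card_bij) auto

lemma S_magic_if_const_block_sums:
  assumes "a \<ge> 1" "b \<ge> 3" "has_block_sums {..<m * b} a S (\<lambda>_. C)" "\<forall>s\<in>S. s > 0"
  shows "S_magic (cycle_blowups m b a) S"
proof -
  obtain e where "bij_betw e ({..<m} \<times> {..<b}) {..<m * b}"
    using bij_betw_blocks by blast
  from has_block_sums_reindex[OF this assms(3)] show ?thesis
    using assms S_magic_iff[OF assms(1,2)] by blast
qed

text \<open>
  If \<open>4\<close> divides \<open>b\<close>, the vertices \<open>j\<close> with \<open>j mod 4 < 2\<close> make up half of the cycle, and exactly one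
  of any two vertices at cyclic distance two is among them.
\<close>

lemma bij_betw_blocks_halves:
  fixes m b :: nat
  assumes "b mod 4 = 0"
  shows "\<exists>e. bij_betw e ({..<m} \<times> {..<b}) {..<m * b} \<and>
    (\<forall>i<m. \<forall>j<b. e (i, j) < m * b div 2 \<longleftrightarrow> j mod 4 < 2)"
proof -
  define A where "A = {..<m} \<times> {j. j < b \<and> j mod 4 < 2}"
  define B where "B = {..<m} \<times> {j. j < b \<and> \<not> j mod 4 < 2}"
  have AB: "A \<union> B = {..<m} \<times> {..<b}" "A \<inter> B = {}" and fin: "finite A" "finite B"
    unfolding A_def B_def by auto
  have "bij_betw (\<lambda>j. j + 2) {j. j < b \<and> j mod 4 < 2} {j. j < b \<and> \<not> j mod 4 < 2}"
  proof (rule bij_betwI[where g = "\<lambda>j. j - 2"])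
    show "(\<lambda>j. j + 2) \<in> {j. j < b \<and> j mod 4 < 2} \<rightarrow> {j. j < b \<and> \<not> j mod 4 < 2}"
    proof (rule funcsetI, clarify)
      fix j assume "j < b" "j mod 4 < 2"
      then show "j + 2 < b \<and> \<not> (j + 2) mod 4 < 2"
        using assms by presburger
    qed
    show "(\<lambda>j. j - 2) \<in> {j. j < b \<and> \<not> j mod 4 < 2} \<rightarrow> {j. j < b \<and> j mod 4 < 2}"
    proof (rule funcsetI, clarify)
      fix j assume j: "j < b" "\<not> j mod 4 < 2"
      then have "j \<ge> 2"
        by (cases "j < 2") auto
      then obtain i where "j = i + 2"
        by (metis le_add_diff_inverse2)
      moreover from this j have "i mod 4 < 2"
        by presburger
      ultimately show "j - 2 < b \<and> (j - 2) mod 4 < 2"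
        using j by simp
    qed
    show "j - 2 + 2 = j" if "j \<in> {j. j < b \<and> \<not> j mod 4 < 2}" for j
      using that by (cases "j < 2") auto
  qed simp
  then have "card A = card B"
    unfolding A_def B_def by (simp add: card_cartesian_product bij_betw_same_card)
  moreover have "card A + card B = m * b"
    using card_Un_disjoint[OF fin AB(2)] AB(1) by (simp add: card_cartesian_product)
  ultimately have card: "card A = m * b div 2" "card B = m * b - m * b div 2"
    by auto
  obtain e1 where e1: "bij_betw e1 A {..<m * b div 2}"
    using finite_same_card_bij[OF fin(1), of "{..<m * b div 2}"] card by auto
  obtain e2 where e2: "bij_betw e2 B {m * b div 2..<m * b}"
    using finite_same_card_bij[OF fin(2), of "{m * b div 2..<m * b}"] card by auto
  define e where "e x = (if x \<in> A then e1 x else e2 x)" for x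
  have A: "bij_betw e A {..<m * b div 2}"
    using e1 by (subst bij_betw_cong[where g = e1]) (auto simp: e_def)
  have B: "bij_betw e B {m * b div 2..<m * b}"
    using e2 AB(2) by (subst bij_betw_cong[where g = e2]) (auto simp: e_def)
  have "{..<m * b div 2} \<union> {m * b div 2..<m * b} = {..<m * b}"
    by auto
  moreover have "bij_betw e (A \<union> B) ({..<m * b div 2} \<union> {m * b div 2..<m * b})"
    using A B by (rule bij_betw_combine) auto
  ultimately have "bij_betw e ({..<m} \<times> {..<b}) {..<m * b}"
    using AB(1) by simp
  moreover have "e (i, j) < m * b div 2 \<longleftrightarrow> j mod 4 < 2" if "i < m" "j < b" for i j
  proof (cases "j mod 4 < 2")
    case True
    then have "(i, j) \<in> A" using that by (simp add: A_def)
    then show ?thesis using True bij_betw_apply[OF A] by auto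
  next
    case False
    then have "(i, j) \<in> B" using that by (simp add: B_def)
    then show ?thesis using False bij_betw_apply[OF B] by fastforce
  qed
  ultimately show ?thesis by blast
qed

lemma S_magic_initial_segment_mod_4:
  assumes "odd a" "a \<ge> 3" "b \<ge> 3" "b mod 4 = 0"
  shows "S_magic (cycle_blowups m b a) {1..m * b * a}"
proof -
  have "even b"
    using assms(4) by presburger
  then have half: "m * b - m * b div 2 = m * b div 2"
    by auto
  obtain C where "has_block_sums {..<m * b} a {1..m * b * a}
      (\<lambda>q. if q < m * b div 2 then C + m * b div 2 else C + m * b div 2 + 1)"
    using has_block_sums_odd[OF assms(1,2), of "m * b" 0] unfolding half add_0_right by auto
  moreover obtain e where e: "bij_betw e ({..<m} \<times> {..<b}) {..<m * b}"
    and e_half: "\<forall>i<m. \<forall>j<b. e (i, j) < m * b div 2 \<longleftrightarrow> j mod 4 < 2"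
    using bij_betw_blocks_halves[OF assms(4)] by blast
  ultimately have sums: "has_block_sums ({..<m} \<times> {..<b}) a {1..m * b * a}
      (\<lambda>x. if e x < m * b div 2 then C + m * b div 2 else C + m * b div 2 + 1)"
    (is "has_block_sums _ _ _ ?w")
    using has_block_sums_reindex by blast
  have "?w (i, j mod b) + ?w (i, (j + 2) mod b) = 2 * (C + m * b div 2) + 1" if "i < m" for i j
  proof -
    have "4 dvd b"
      using assms(4) by presburger
    then have "x mod b mod 4 = x mod 4" for x
      by (rule mod_mod_cancel)
    then have "e (i, x mod b) < m * b div 2 \<longleftrightarrow> x mod 4 < 2" for x
      using e_half that assms(3) by simp
    moreover have "j mod 4 < 2 \<longleftrightarrow> \<not> (j + 2) mod 4 < 2"
      by presburger
    ultimately show ?thesis by simp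
  qed
  then show ?thesis
    using sums assms S_magic_iff[of a b m "{1..m * b * a}"] by auto
qed

lemma not_S_magic_initial_segment:
  assumes "m \<ge> 1" "b \<ge> 3" "odd a" "even (m * b)" "b mod 4 \<noteq> 0"
  shows "\<not> S_magic (cycle_blowups m b a) {1..m * b * a}"
proof
  assume "S_magic (cycle_blowups m b a) {1..m * b * a}"
  moreover have "a \<ge> 1"
    using assms(3) by (cases a) auto
  ultimately obtain w \<mu> where w: "has_block_sums ({..<m} \<times> {..<b}) a {1..m * b * a} w"
    and \<mu>: "\<And>i j. i < m \<Longrightarrow> w (i, j mod b) + w (i, (j + 2) mod b) = \<mu>"
    using S_magic_iff[of a b m "{1..m * b * a}"] assms(2) by auto
  have period: "w (i, (j + 4 * t) mod b) = w (i, j mod b)" if "i < m" for i j t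
  proof (induction t)
    case (Suc t)
    have "w (i, (j + 4 * t + 2 + 2) mod b) = w (i, (j + 4 * t) mod b)"
      using \<mu>[OF that, of "j + 4 * t"] \<mu>[OF that, of "j + 4 * t + 2"] by linarith
    moreover have "j + 4 * t + 2 + 2 = j + 4 * Suc t"
      by simp
    ultimately show ?case
      using Suc by metis
  qed simp
  have const: "2 * w (i, j) = \<mu>" if "i < m" "j < b" for i j
  proof -
    \<comment> \<open>A step of two is, modulo \<open>b\<close>, a multiple of four: add \<open>b\<close> if \<open>b mod 4 = 2\<close>, and \<open>2 b\<close> if \<open>b\<close> is odd.\<close>
    obtain s t where "2 + b * s = 4 * t"
    proof (cases "even b")
      case True
      then have "2 + b * 1 = 4 * ((b + 2) div 4)"
        using assms(5) by presburger
      then show ?thesis using that by blast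
    next
      case False
      then have "2 + b * 2 = 4 * ((b + 1) div 2)"
        by presburger
      then show ?thesis using that by blast
    qed
    then have "j + 2 + b * s = j + 4 * t"
      by simp
    then have "(j + 2) mod b = (j + 4 * t) mod b"
      by (metis mod_mult_self2)
    then show ?thesis
      using \<mu>[OF that(1), of j] period[OF that(1), of j t] that(2) by simp
  qed
  have "m * b * \<mu> = (\<Sum>x\<in>{..<m} \<times> {..<b}. 2 * w x)"
  proof -
    have "(\<Sum>x\<in>{..<m} \<times> {..<b}. 2 * w x) = (\<Sum>x\<in>{..<m} \<times> {..<b}. \<mu>)"
      using const by (intro sum.cong) auto
    then show ?thesis
      by (simp add: card_cartesian_product)
  qed
  also have "\<dots> = 2 * \<Sum>{1..m * b * a}"
    using has_block_sums_total[OF w] by (simp add: sum_distrib_left[symmetric])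
  also have "\<dots> = m * b * (a * (m * b * a + 1))"
    using double_gauss_sum_from_Suc_0[of "m * b * a", where ?'a = nat] by (simp add: algebra_simps)
  finally have "\<mu> = a * (m * b * a + 1)"
    using assms(1,2) by simp
  then have "odd \<mu>"
    using assms(3,4) by simp
  moreover have "even \<mu>"
    using const[of 0 0] assms(1,2) by (metis dvd_triv_left less_le_trans zero_less_numeral zero_less_one)
  ultimately show False by blast
qed

theorem theorem3p3:
  fixes m a b :: nat
  assumes "m \<ge> 1" and "a > 1" and "b \<ge> 3"
  shows "distance_magic_index
           (disjoint_copies m (lexicographic_product (cycle_graph b) (empty_graph a))) =
         (if even a \<or> odd (m * a * b) \<or> (odd a \<and> b mod 4 = 0) then 0 else 1)"
proof -
  let ?G = "cycle_blowups m b a"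
  have ab: "a \<ge> 1" "b \<ge> 3" using assms by auto
  have card: "card (pverts ?G) = m * b * a"
    unfolding pverts_cycle_blowups by (simp add: card_cartesian_product)
  have "(0, 0, 0) \<in> pverts ?G"
    unfolding pverts_cycle_blowups using assms by auto
  then have ne: "pverts ?G \<noteq> {}"
    by blast
  have fin: "finite (pverts ?G)"
    unfolding pverts_cycle_blowups by simp
  have a3: "a \<ge> 3" if "odd a"
    using that assms(2) by presburger
  show ?thesis
  proof (cases "even a \<or> odd (m * a * b) \<or> (odd a \<and> b mod 4 = 0)")
    case True
    have "S_magic ?G {1..m * b * a}"
    proof (cases "odd a \<and> b mod 4 = 0")
      case True
      then show ?thesis
        using S_magic_initial_segment_mod_4[of a b m] a3 assms(3) by simp
    next
      case False
      have "\<exists>C. has_block_sums {..<m * b} a {1..m * b * a} (\<lambda>_. C)"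
      proof (cases "even a")
        case True
        then show ?thesis by (rule has_block_sums_even)
      next
        case False
        with \<open>\<not> (odd a \<and> b mod 4 = 0)\<close> True have "odd (m * b)"
          by auto
        then have half: "m * b - m * b div 2 = m * b div 2 + 1"
          by (elim oddE) simp
        obtain C where C: "has_block_sums {..<m * b} a
            ({1..m * b * a + 0} - {m * b + m * b div 2 + 1..m * b + m * b div 2 + 0})
            (\<lambda>q. if q < m * b div 2 + 1 then C + (m * b div 2 + 1) + 0 else C + m * b div 2 + 1)"
          using has_block_sums_odd[OF False a3[OF False], of "m * b" 0] unfolding half by blast
        have "has_block_sums {..<m * b} a {1..m * b * a} (\<lambda>_. C + m * b div 2 + 1)"
          using has_block_sums_cong[OF C, of "\<lambda>_. C + m * b div 2 + 1"] by simp
        then show ?thesis ..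
      qed
      then show ?thesis
        by (auto intro: S_magic_if_const_block_sums[OF ab])
    qed
    then show ?thesis
      using True distance_magic_index_eq_0[of ?G] ne fin card by simp
  next
    case False
    then have odd: "odd a" and even: "even (m * b)" and b4: "b mod 4 \<noteq> 0"
      by auto
    define k where "k = m * b"
    define S where "S = {1..k * a + 1} - {k + k div 2 + 1}"
    have half: "k - k div 2 = k div 2"
      using even unfolding k_def by auto
    obtain C where "has_block_sums {..<k} a S (\<lambda>_. C)"
      using has_block_sums_odd[OF odd a3[OF odd], of k 1]
      unfolding S_def half atLeastAtMost_singleton if_cancel by blast
    then have "S_magic ?G S"
      unfolding k_def by (rule S_magic_if_const_block_sums[OF ab]) (auto simp: S_def)
    moreover have "Max S = k * a + 1"
    proof (rule Max_eqI)
      have "k > 0"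
        using assms unfolding k_def by simp
      moreover have "k * 3 \<le> k * a"
        using a3[OF odd] by simp
      ultimately have "k + k div 2 < k * a"
        by linarith
      then show "k * a + 1 \<in> S"
        unfolding S_def by simp
    qed (auto simp: S_def)
    moreover have "\<not> S_magic ?G {1..m * b * a}"
      using not_S_magic_initial_segment[OF assms(1,3) odd even b4] .
    ultimately show ?thesis
      using distance_magic_index_eq_1[of ?G S] card unfolding k_def if_not_P[OF False] by simp
  qed
qed

end
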